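(* Let $D\subset\mathbb{R}^n$ be a closed disk. There exist a sequence $\{f_k\}_{k\in\mathbb{N}}$ of maps in $\mathcal{C}^1(D,\mathbb{R})$, such that the sequence $\kappa_1(f_k,D)$ converges to $+\infty$, and a constant $c_0=c_0(D)>0$ such that for every $k\in\mathbb{N}$ the zero set $Z(f_k)\subset\mathrm{int}(D)$ is regular and $$b(Z(f_k))\ge c_0\cdot\left(\kappa_1(f_k,D)\right)^n.$$
   Context: $Z(f)=\{x\in D:f(x)=0\}$; it is regular if $\nabla f(x)\ne0$ for every $x\in Z(f)$. $b(Z)$ is the sum of the Betti numbers of $Z$. For $f\in\mathcal{C}^1(D,\mathbb{R})$ put $$\nu_1(f,D)=\sup_{x\in D}\left(|f(x)|^2+\|\nabla f(x)\|^2\right)^{1/2},\quad\delta(f,D)=\inf_{x\in D}\left(|f(x)|^2+\|\nabla f(x)\|^2\right)^{1/2},\quad m(f,D)=\min_{x\in\partial D}|f(x)|,$$ $$\kappa_1(f,D)=\frac{\nu_1(f,D)}{\min\{m(f,D),\delta(f,D)\}}.$$ *)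

theory Defs
  imports "HOL-Analysis.Analysis" "HOL-Homology.Homology"
begin

(* The derivative is taken relative to D, so at boundary points it only sees values of f on D. *)
definition gradient_on :: "'a::euclidean_space set \<Rightarrow> ('a \<Rightarrow> real) \<Rightarrow> 'a \<Rightarrow> 'a"
  where "gradient_on D f x = (THE g. (f has_derivative (\<lambda>h. g \<bullet> h)) (at x within D))"

lemma gradient_unique_cball:
  fixes a :: "'a::euclidean_space"
  assumes r: "r > 0" and x: "x \<in> cball a r"
    and g: "(f has_derivative (\<lambda>h. g \<bullet> h)) (at x within cball a r)"
    and g': "(f has_derivative (\<lambda>h. g' \<bullet> h)) (at x within cball a r)"
  shows "g = g'"
proof -
  have D0: "((\<lambda>y. 0::real) has_derivative (\<lambda>h. (g - g') \<bullet> h)) (at x within cball a r)"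
    using has_derivative_diff[OF g g'] by (simp add: inner_diff_left)
  have orth: "(g - g') \<bullet> (p - x) = 0" if p: "p \<in> cball a r" for p
  proof -
    let ?l = "\<lambda>t::real. x + t *\<^sub>R (p - x)"
    have im: "?l ` {0..1} \<subseteq> cball a r"
    proof clarify
      fix t :: real assume "t \<in> {0..1}"
      then have "(1 - t) *\<^sub>R x + t *\<^sub>R p \<in> cball a r"
        using x p by (intro convexD[OF convex_cball]) auto
      then show "x + t *\<^sub>R (p - x) \<in> cball a r" by (simp add: algebra_simps)
    qed
    have l: "(?l has_derivative (\<lambda>t. t *\<^sub>R (p - x))) (at 0 within {0..1})"
      by (auto intro!: derivative_eq_intros)
    have "((\<lambda>y. 0::real) has_derivative (\<lambda>h. (g - g') \<bullet> h)) (at (?l 0) within ?l ` {0..1})"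
      using has_derivative_subset[OF D0 im] by simp
    from has_derivative_in_compose[OF l this]
    have "((\<lambda>t::real. 0::real) has_vector_derivative ((g - g') \<bullet> (p - x))) (at 0 within {0..1})"
      by (simp add: has_vector_derivative_def)
    then show ?thesis
      using vector_derivative_unique_within_closed_interval[of 0 1 0, OF _ _ _ has_vector_derivative_const]
      by auto
  qed
  define d where "d = g - g'"
  have "a + (r / (norm d + 1)) *\<^sub>R d \<in> cball a r"
    using r by (simp add: dist_norm field_simps add_pos_nonneg)
  from orth[OF this] orth[of a] r have "(r / (norm d + 1)) * (d \<bullet> d) = 0"
    by (simp add: d_def[symmetric] inner_diff_right inner_add_right)
  then have "d = 0" using r by (simp add: add_nonneg_eq_0_iff)
  then show ?thesis by (simp add: d_def)
qed

(* C^1(D, R) for a closed ball D: differentiability up to and including the boundary, with a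
   gradient continuous on all of D.  By convexity and Whitney's extension theorem this is the same
   as being the restriction to D of a C^1 function on the whole space. *)
definition C1_on :: "'a::euclidean_space set \<Rightarrow> ('a \<Rightarrow> real) \<Rightarrow> bool"
  where "C1_on D f \<longleftrightarrow>
    (\<forall>x\<in>D. (f has_derivative (\<lambda>h. gradient_on D f x \<bullet> h)) (at x within D)) \<and>
    continuous_on D (gradient_on D f)"

definition zero_set :: "'a::euclidean_space set \<Rightarrow> ('a \<Rightarrow> real) \<Rightarrow> 'a set"
  where "zero_set D f = {x \<in> D. f x = 0}"

definition regular_zero_set :: "'a::euclidean_space set \<Rightarrow> ('a \<Rightarrow> real) \<Rightarrow> bool"
  where "regular_zero_set D f \<longleftrightarrow> (\<forall>x\<in>zero_set D f. gradient_on D f x \<noteq> 0)"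

(* For D compact and f in C^1(D, R) the suprema and infima below range over bounded nonempty sets
   of reals (and the infimum defining m is attained when the frontier is nonempty). *)
definition nu1 :: "('a::euclidean_space \<Rightarrow> real) \<Rightarrow> 'a set \<Rightarrow> real"
  where "nu1 f D = (SUP x\<in>D. sqrt (\<bar>f x\<bar>\<^sup>2 + (norm (gradient_on D f x))\<^sup>2))"

definition delta :: "('a::euclidean_space \<Rightarrow> real) \<Rightarrow> 'a set \<Rightarrow> real"
  where "delta f D = (INF x\<in>D. sqrt (\<bar>f x\<bar>\<^sup>2 + (norm (gradient_on D f x))\<^sup>2))"

definition boundary_min :: "('a::euclidean_space \<Rightarrow> real) \<Rightarrow> 'a set \<Rightarrow> real"
  where "boundary_min f D = (INF x\<in>frontier D. \<bar>f x\<bar>)"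

(* If the denominator vanishes, division returns 0 rather than infinity.  This cannot happen for f
   in C^1(D, R) on a closed ball D whose zero set is regular and contained in the interior. *)
definition kappa1 :: "('a::euclidean_space \<Rightarrow> real) \<Rightarrow> 'a set \<Rightarrow> real"
  where "kappa1 f D = nu1 f D / min (boundary_min f D) (delta f D)"

(* Linear independence over the integers in a multiplicatively written abelian group. *)
definition int_independent :: "('a, 'b) monoid_scheme \<Rightarrow> 'a set \<Rightarrow> bool"
  where "int_independent G S \<longleftrightarrow>
    finite S \<and> S \<subseteq> carrier G \<and>
    (\<forall>c :: 'a \<Rightarrow> int. (\<Otimes>\<^bsub>G\<^esub>x\<in>S. x [^]\<^bsub>G\<^esub> c x) = \<one>\<^bsub>G\<^esub> \<longrightarrow> (\<forall>x\<in>S. c x = 0))"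

definition abelian_rank :: "('a, 'b) monoid_scheme \<Rightarrow> enat"
  where "abelian_rank G = (SUP S\<in>{S. int_independent G S}. enat (card S))"

(* Ranks of the integral singular homology groups. *)
definition betti_number :: "nat \<Rightarrow> 'a topology \<Rightarrow> enat"
  where "betti_number p X = abelian_rank (homology_group (int p) X)"

definition total_betti :: "'a::topological_space set \<Rightarrow> ennreal"
  where "total_betti Z = suminf (\<lambda>p. ennreal_of_enat (betti_number p (top_of_set Z)))"

end

theory Submission
  imports Defs
begin

text \<open>Place disjoint balls of small radius \<open>\<rho>\<close>, about \<open>(1/\<rho>)\<^sup>n\<close> of them,
  inside the disk.  Let \<open>f\<close> be \<open>1\<close> outside of them, and let it descend to \<open>-1\<close> at each centre by a
  \<open>C\<^sup>1\<close> bump.  The gradient is of size \<open>1/\<rho>\<close>, while \<open>\<bar>f\<bar>\<^sup>2 + \<parallel>\<nabla>f\<parallel>\<^sup>2 \<ge> 1\<close> everywhere, so \<open>\<kappa>\<^sub>1\<close> is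
  comparable to \<open>1/\<rho>\<close>.  Every ball contains a separate piece of the zero set, so already the zeroth
  Betti number is at least the number of balls.\<close>

section \<open>The zeroth Betti number\<close>

text \<open>An isomorphism carries distinct generators \<open>frag_of s\<close> to distinct elements
  \<open>e s\<close>. A relation among these pulls back to a vanishing formal sum, where every
  coefficient must be 0.\<close>

lemma card_le_abelian_rank:
  fixes G :: "('a, 'b) monoid_scheme" and P :: "'c set"
  assumes G: "comm_group G" and iso: "G \<cong> free_Abelian_group P"
    and S: "finite S" "S \<subseteq> P"
  shows "enat (card S) \<le> abelian_rank G"
proof -
  interpret G: comm_group G by (rule G)
  obtain h where h: "h \<in> iso (free_Abelian_group P) G"
    using iso G.iso_sym is_iso_def by blast
  interpret h: group_hom "free_Abelian_group P" G h
    using h by (simp add: group_hom_def group_hom_axioms_def iso_def G.is_group)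
  have inj: "inj_on h (carrier (free_Abelian_group P))"
    using h by (auto simp: iso_def bij_betw_def)
  define e where "e s = h (frag_of s)" for s
  have e_in: "e s \<in> carrier G" if "s \<in> P" for s
    unfolding e_def using that by (intro h.hom_closed) simp
  have e_inj: "inj_on e P"
  proof (rule inj_onI)
    fix s t assume "s \<in> P" "t \<in> P" "e s = e t"
    then have "frag_of s = frag_of t"
      unfolding e_def by (intro inj_onD[OF inj]) auto
    then show "s = t" by (simp add: frag_of_eq)
  qed
  \<comment> \<open>Independence quantifies over exponents \<open>c\<close> on the group, so the
    coefficient of \<open>s\<close> is taken to be \<open>c (e s)\<close>. Carrier membership is
    carried through the induction because multiplicativity of \<open>h\<close> requires it.\<close>
  have hom: "(\<Sum>s\<in>T. frag_cmul (c (e s)) (frag_of s)) \<in> carrier (free_Abelian_group P) \<and>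
      h (\<Sum>s\<in>T. frag_cmul (c (e s)) (frag_of s)) = (\<Otimes>\<^bsub>G\<^esub>x\<in>e ` T. x [^]\<^bsub>G\<^esub> c x)"
    if "finite T" "T \<subseteq> P" for T and c :: "'a \<Rightarrow> int"
    using that
  proof (induction T rule: finite_induct)
    case empty
    then show ?case using h.hom_one by simp
  next
    case (insert t T)
    let ?z = "\<Sum>s\<in>T. frag_cmul (c (e s)) (frag_of s)"
    have t: "t \<in> P" and IH: "?z \<in> carrier (free_Abelian_group P)"
        "h ?z = (\<Otimes>\<^bsub>G\<^esub>x\<in>e ` T. x [^]\<^bsub>G\<^esub> c x)"
      using insert by auto
    have pow: "h (frag_cmul (c (e t)) (frag_of t)) = e t [^]\<^bsub>G\<^esub> c (e t)"
      using h.hom_int_pow[of "frag_of t" "c (e t)"] t by (simp add: e_def)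
    have in1: "frag_cmul (c (e t)) (frag_of t) \<in> carrier (free_Abelian_group P)"
      using t keys_cmul[of "c (e t)" "frag_of t"] by auto
    have nin: "e t \<notin> e ` T"
      using e_inj insert by (auto simp: inj_on_def)
    have "h (frag_cmul (c (e t)) (frag_of t) + ?z) =
        h (frag_cmul (c (e t)) (frag_of t)) \<otimes>\<^bsub>G\<^esub> h ?z"
      using h.hom_mult[OF in1 IH(1)] by simp
    also have "\<dots> = (\<Otimes>\<^bsub>G\<^esub>x\<in>e ` insert t T. x [^]\<^bsub>G\<^esub> c x)"
      using insert nin e_in
      by (simp add: pow IH(2)) (subst G.finprod_insert, auto simp: subset_iff)
    finally have 1: "h (frag_cmul (c (e t)) (frag_of t) + ?z) = \<dots>" .
    have "frag_cmul (c (e t)) (frag_of t) + ?z \<in> carrier (free_Abelian_group P)"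
      using h.G.m_closed[OF in1 IH(1)] by simp
    with 1 insert show ?case by simp
  qed
  have "int_independent G (e ` S)"
    unfolding int_independent_def
  proof (intro conjI allI impI ballI)
    fix c :: "'a \<Rightarrow> int" and x
    assume prod: "(\<Otimes>\<^bsub>G\<^esub>x\<in>e ` S. x [^]\<^bsub>G\<^esub> c x) = \<one>\<^bsub>G\<^esub>" and "x \<in> e ` S"
    then obtain t where t: "t \<in> S" "x = e t" by auto
    let ?z = "\<Sum>s\<in>S. frag_cmul (c (e s)) (frag_of s)"
    have "h ?z = h 0"
      using hom[OF S, of c] prod h.hom_one by simp
    then have z: "?z = 0"
      using hom[OF S, of c] by (intro inj_onD[OF inj]) auto
    \<comment> \<open>Reading off the coefficient of the generator \<open>t\<close> isolates
      \<open>c (e t)\<close>.\<close>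
    have "0 = poly_mapping.lookup ?z t" by (simp add: z)
    also have "\<dots> = (\<Sum>s\<in>S. if s = t then c (e s) else 0)"
      by (auto simp: lookup_sum intro!: sum.cong)
    also have "\<dots> = c (e t)" using t S by simp
    finally show "c x = 0" using t by simp
  qed (use S e_in in auto)
  then have "enat (card (e ` S)) \<le> abelian_rank G"
    unfolding abelian_rank_def by (intro SUP_upper) simp
  moreover have "card (e ` S) = card S"
    by (rule card_image) (rule inj_on_subset[OF e_inj S(2)])
  ultimately show ?thesis by simp
qed

lemma card_le_betti_number_0:
  assumes "finite S" "S \<subseteq> path_components_of X"
  shows "enat (card S) \<le> betti_number 0 X"
  unfolding betti_number_def
  using card_le_abelian_rank[OF _ zeroth_homology_group[of X] assms] by simp

text \<open>A path component of \<open>Z\<close> is connected, so it cannot meet two of the disjoint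
  open sets covering \<open>Z\<close>. The points \<open>q i\<close> thus lie in different path
  components. The shape of the individual pieces of \<open>Z\<close> need not be determined.\<close>

lemma card_le_total_betti:
  fixes Z :: "'a::topological_space set"
  assumes fin: "finite I" and disj: "disjoint_family_on U I" and op: "\<And>i. i \<in> I \<Longrightarrow> open (U i)"
    and cover: "Z \<subseteq> (\<Union>i\<in>I. U i)" and q: "\<And>i. i \<in> I \<Longrightarrow> q i \<in> Z \<inter> U i"
  shows "of_nat (card I) \<le> total_betti Z"
proof -
  let ?X = "top_of_set Z"
  let ?C = "\<lambda>i. path_component_of_set ?X (q i)"
  have sub: "?C i \<subseteq> U i" if i: "i \<in> I" for i
  proof -
    have "path_connectedin ?X (?C i)"
      by (simp add: path_connectedin_path_component_of)
    then have conn: "connected (?C i)" and CZ: "?C i \<subseteq> Z"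
      by (auto simp: path_connectedin_subtopology intro: path_connected_imp_connected)
    have q_in: "q i \<in> ?C i" using q[OF i] by (simp add: path_component_of_refl)
    \<comment> \<open>\<open>U i\<close> and \<open>?V\<close> are disjoint open sets covering
      \<open>Z\<close>, so a connected subset of \<open>Z\<close> lies in one of them;
      \<open>q i\<close> selects \<open>U i\<close>.\<close>
    let ?V = "\<Union>j\<in>I - {i}. U j"
    have "U i \<inter> ?V = {}"
      using disj i by (force simp: disjoint_family_on_def)
    moreover have "open ?V" "open (U i)" using op i by auto
    moreover have "?C i \<subseteq> U i \<union> ?V" using CZ cover by blast
    ultimately have "U i \<inter> ?C i = {} \<or> ?V \<inter> ?C i = {}"
      using connectedD[OF conn] by blast
    then show ?thesis using q_in q[OF i] \<open>?C i \<subseteq> U i \<union> ?V\<close> by blast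
  qed
  have "inj_on ?C I"
  proof (rule inj_onI, rule ccontr)
    fix i j assume ij: "i \<in> I" "j \<in> I" "?C i = ?C j" "i \<noteq> j"
    have "q i \<in> ?C i" using q[OF ij(1)] by (simp add: path_component_of_refl)
    then have "q i \<in> U i \<inter> U j" using sub[OF ij(1)] sub[OF ij(2)] ij(3) by blast
    then show False using disj ij by (auto simp: disjoint_family_on_def)
  qed
  then have "card I = card (?C ` I)" by (simp add: card_image)
  moreover have "?C ` I \<subseteq> path_components_of ?X"
    using q by (auto simp: path_components_of_def)
  ultimately have "enat (card I) \<le> betti_number 0 ?X"
    using card_le_betti_number_0[of "?C ` I" ?X] fin by simp
  then have "ennreal_of_enat (enat (card I)) \<le> ennreal_of_enat (betti_number 0 ?X)"
    by (rule ennreal_of_enat_le_iff[THEN iffD2])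
  also have "\<dots> \<le> total_betti Z"
    unfolding total_betti_def
    using sum_le_suminf[of "\<lambda>p. ennreal_of_enat (betti_number p ?X)" "{0}"] by simp
  finally show ?thesis by simp
qed

section \<open>Superposed bumps\<close>

text \<open>Squaring makes the truncation \<open>C^1\<close> at \<open>s = 1\<close>. The argument
  will be a squared scaled distance, which keeps the composite differentiable at the centre
  too.\<close>

definition bump :: "real \<Rightarrow> real"
  where "bump s = (max 0 (1 - s))\<^sup>2"

lemma bump_has_derivative: "(bump has_real_derivative - 2 * max 0 (1 - s)) (at s)"
proof -
  consider "s < 1" | "s > 1" | "s = 1" by linarith
  then show ?thesis
  proof cases
    case 1
    have "((\<lambda>s. (1 - s)\<^sup>2) has_real_derivative - 2 * max 0 (1 - s)) (at s)"
      using 1 by (auto intro!: derivative_eq_intros)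
    then show ?thesis
      by (rule has_field_derivative_transform_within_open[of _ _ _ "{..<1}"])
         (use 1 in \<open>auto simp: bump_def\<close>)
  next
    case 2
    have "((\<lambda>s. 0) has_real_derivative - 2 * max 0 (1 - s)) (at s)"
      using 2 by auto
    then show ?thesis
      by (rule has_field_derivative_transform_within_open[of _ _ _ "{1<..}"])
         (use 2 in \<open>auto simp: bump_def\<close>)
  next
    case 3
    \<comment> \<open>At the gluing point \<open>bump (1 + h)\<close> is either 0 or
      \<open>h^2\<close>, so the difference quotient is at most \<open>\<bar>h\<bar>\<close> in
      absolute value.\<close>
    have "((\<lambda>h. (bump (s + h) - bump s) / h) \<longlongrightarrow> 0) (at 0)"
    proof (rule Lim_null_comparison)
      show "\<forall>\<^sub>F h in at 0. norm ((bump (s + h) - bump s) / h) \<le> \<bar>h\<bar>"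
        using 3 by (intro always_eventually) (auto simp: bump_def max_def power2_eq_square)
      show "((\<lambda>h::real. \<bar>h\<bar>) \<longlongrightarrow> 0) (at 0)"
        by (rule tendsto_rabs_zero) (rule tendsto_ident_at)
    qed
    then show ?thesis using 3 by (simp add: DERIV_def)
  qed
qed

definition bumps :: "real \<Rightarrow> 'a::euclidean_space set \<Rightarrow> 'a \<Rightarrow> real"
  where "bumps \<rho> P x = 1 - 2 * (\<Sum>p\<in>P. bump ((x - p) \<bullet> (x - p) / \<rho>\<^sup>2))"

text \<open>The factor 8 is the product of -2 from \<open>bumps\<close>, -2 from the derivative of
  \<open>bump\<close>, and 2 from the derivative of the squared norm.\<close>

definition grad_bumps :: "real \<Rightarrow> 'a::euclidean_space set \<Rightarrow> 'a \<Rightarrow> 'a"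
  where "grad_bumps \<rho> P x =
    (\<Sum>p\<in>P. (8 * max 0 (1 - (x - p) \<bullet> (x - p) / \<rho>\<^sup>2) / \<rho>\<^sup>2) *\<^sub>R (x - p))"

lemma bumps_has_derivative:
  "(bumps \<rho> P has_derivative (\<lambda>h. grad_bumps \<rho> P x \<bullet> h)) (at x within D)"
proof -
  have 1: "((\<lambda>x. bump ((x - p) \<bullet> (x - p) / \<rho>\<^sup>2)) has_derivative
      (\<lambda>h. (- 2 * max 0 (1 - (x - p) \<bullet> (x - p) / \<rho>\<^sup>2)) * (2 * ((x - p) \<bullet> h) / \<rho>\<^sup>2)))
      (at x within D)" for p
  proof -
    have "((\<lambda>x. (x - p) \<bullet> (x - p) / \<rho>\<^sup>2) has_derivative (\<lambda>h. 2 * ((x - p) \<bullet> h) / \<rho>\<^sup>2))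
        (at x within D)"
      by (auto intro!: derivative_eq_intros simp: inner_commute divide_inverse algebra_simps)
    from has_derivative_compose[OF this bump_has_derivative[unfolded has_field_derivative_def]]
    show ?thesis by (simp add: mult.commute)
  qed
  have "((\<lambda>x. 1 - 2 * (\<Sum>p\<in>P. bump ((x - p) \<bullet> (x - p) / \<rho>\<^sup>2))) has_derivative
      (\<lambda>h. 0 - 2 * (\<Sum>p\<in>P. (- 2 * max 0 (1 - (x - p) \<bullet> (x - p) / \<rho>\<^sup>2)) * (2 * ((x - p) \<bullet> h) / \<rho>\<^sup>2))))
      (at x within D)"
    by (intro has_derivative_diff has_derivative_const has_derivative_mult_right has_derivative_sum 1)
  moreover have "(\<lambda>h. 0 - 2 * (\<Sum>p\<in>P. (- 2 * max 0 (1 - (x - p) \<bullet> (x - p) / \<rho>\<^sup>2)) * (2 * ((x - p) \<bullet> h) / \<rho>\<^sup>2)))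
      = (\<lambda>h. grad_bumps \<rho> P x \<bullet> h)"
    unfolding grad_bumps_def inner_sum_left diff_0 sum_distrib_left sum_negf[symmetric]
    by (intro ext sum.cong refl) simp
  ultimately show ?thesis unfolding bumps_def[abs_def] by simp
qed

lemma continuous_on_grad_bumps: "continuous_on D (grad_bumps \<rho> P)"
  unfolding grad_bumps_def[abs_def] divide_inverse by (intro continuous_intros)

text \<open>\<open>gradient_on\<close> is a definite description relative to the ball, so the
  explicit formula must be shown to be the only candidate, also at boundary points.\<close>

lemma gradient_on_bumps:
  assumes "r > 0" "x \<in> cball a r"
  shows "gradient_on (cball a r) (bumps \<rho> P) x = grad_bumps \<rho> P x"
  unfolding gradient_on_def
proof (rule the_equality)
  let ?d = "\<lambda>g. (bumps \<rho> P has_derivative (\<lambda>h. g \<bullet> h)) (at x within cball a r)"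
  show d: "?d (grad_bumps \<rho> P x)" by (rule bumps_has_derivative)
  show "g = grad_bumps \<rho> P x" if "?d g" for g
    using assms that d by (rule gradient_unique_cball)
qed

lemma C1_on_bumps:
  assumes "r > 0"
  shows "C1_on (cball a r) (bumps \<rho> P)"
  unfolding C1_on_def
proof
  show "\<forall>x\<in>cball a r. (bumps \<rho> P has_derivative
      (\<lambda>h. gradient_on (cball a r) (bumps \<rho> P) x \<bullet> h)) (at x within cball a r)"
    using assms by (simp add: gradient_on_bumps bumps_has_derivative)
  show "continuous_on (cball a r) (gradient_on (cball a r) (bumps \<rho> P))"
    using continuous_on_grad_bumps
    by (rule continuous_on_eq) (simp add: gradient_on_bumps[OF assms])
qed

section \<open>Pointwise values and bounds for the superposed bumps\<close>

lemma scaled_inner_ge_1_iff: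
  fixes x p :: "'a::euclidean_space"
  assumes "\<rho> > 0"
  shows "(x - p) \<bullet> (x - p) / \<rho>\<^sup>2 \<ge> 1 \<longleftrightarrow> x \<notin> ball p \<rho>"
  using assms
  by (simp add: le_divide_eq dot_square_norm dist_norm norm_minus_commute not_less)

lemma bumps_outside:
  assumes "\<rho> > 0" "\<And>p. p \<in> P \<Longrightarrow> x \<notin> ball p \<rho>"
  shows "bumps \<rho> P x = 1" "grad_bumps \<rho> P x = 0"
proof -
  have far: "max 0 (1 - (x - p) \<bullet> (x - p) / \<rho>\<^sup>2) = 0" if "p \<in> P" for p
    using scaled_inner_ge_1_iff[OF assms(1), of x p] assms(2)[OF that] by simp
  show "bumps \<rho> P x = 1" "grad_bumps \<rho> P x = 0"
    by (simp_all add: bumps_def bump_def grad_bumps_def far)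
qed

text \<open>By disjointness only the centre \<open>p\<close> contributes at \<open>x\<close>, so
  value and gradient norm depend on the single parameter \<open>s\<close>. The norm formula uses
  that the squared norm of \<open>x - p\<close> is \<open>s * \<rho>^2\<close>.\<close>

lemma bumps_inside:
  assumes "\<rho> > 0" "finite P" "disjoint_family_on (\<lambda>p. ball p \<rho>) P" "p \<in> P" "x \<in> ball p \<rho>"
  defines "s \<equiv> (x - p) \<bullet> (x - p) / \<rho>\<^sup>2"
  shows "bumps \<rho> P x = 1 - 2 * (1 - s)\<^sup>2"
    and "norm (grad_bumps \<rho> P x) ^ 2 = 64 * (1 - s)\<^sup>2 * s / \<rho>\<^sup>2"
    and "0 \<le> s" "s < 1"
proof -
  have far: "(x - q) \<bullet> (x - q) / \<rho>\<^sup>2 \<ge> 1" if "q \<in> P - {p}" for q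
  proof -
    have "x \<notin> ball q \<rho>" using disjoint_family_onD[OF assms(3,4), of q] assms(5) that
      by (auto simp: disjoint_iff)
    then show ?thesis using scaled_inner_ge_1_iff[OF assms(1)] by blast
  qed
  show s1: "s < 1"
    using scaled_inner_ge_1_iff[OF assms(1), of x p] assms(5) by (simp add: s_def)
  show "0 \<le> s" by (simp add: s_def)
  have "(\<Sum>q\<in>P. bump ((x - q) \<bullet> (x - q) / \<rho>\<^sup>2)) = (1 - s)\<^sup>2"
    unfolding sum.remove[OF assms(2,4)]
    using far s1 by (simp add: s_def[symmetric] bump_def)
  then show "bumps \<rho> P x = 1 - 2 * (1 - s)\<^sup>2" by (simp add: bumps_def)
  have "grad_bumps \<rho> P x = (8 * (1 - s) / \<rho>\<^sup>2) *\<^sub>R (x - p)"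
    unfolding grad_bumps_def sum.remove[OF assms(2,4)]
    using far s1 by (simp add: s_def[symmetric])
  then have "norm (grad_bumps \<rho> P x) ^ 2 = (8 * (1 - s) / \<rho>\<^sup>2)\<^sup>2 * (s * \<rho>\<^sup>2)"
    using assms(1) s1
    by (simp add: s_def dot_square_norm power_divide power_mult_distrib del: right_diff_distrib_numeral)
  also have "\<dots> = 64 * (1 - s)\<^sup>2 * s / \<rho>\<^sup>2"
    using assms(1) by (simp add: field_simps power2_eq_square)
  finally show "norm (grad_bumps \<rho> P x) ^ 2 = 64 * (1 - s)\<^sup>2 * s / \<rho>\<^sup>2" .
qed

text \<open>Since \<open>\<rho> \<le> 1\<close>, the lower bound reduces to
  \<open>\<rho> = 1\<close>, a polynomial inequality in one variable. For the upper bound the value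
  contributes at most 1 and the squared gradient norm at most \<open>64 / \<rho>^2\<close>.\<close>

lemma bumps_energy_bounds:
  assumes \<rho>: "0 < \<rho>" "\<rho> \<le> 1" and P: "finite P" "disjoint_family_on (\<lambda>p. ball p \<rho>) P"
  shows "1 \<le> (bumps \<rho> P x)\<^sup>2 + (norm (grad_bumps \<rho> P x))\<^sup>2"
    and "(bumps \<rho> P x)\<^sup>2 + (norm (grad_bumps \<rho> P x))\<^sup>2 \<le> (9 / \<rho>)\<^sup>2"
proof -
  have \<rho>2: "\<rho>\<^sup>2 \<le> 1" "0 < \<rho>\<^sup>2" using \<rho> by (auto simp: power_le_one)
  have "1 \<le> (bumps \<rho> P x)\<^sup>2 + (norm (grad_bumps \<rho> P x))\<^sup>2 \<and>
    (bumps \<rho> P x)\<^sup>2 + (norm (grad_bumps \<rho> P x))\<^sup>2 \<le> 65 / \<rho>\<^sup>2"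
  proof (cases "\<exists>p\<in>P. x \<in> ball p \<rho>")
    case False
    then show ?thesis using bumps_outside[OF \<rho>(1), of P x] \<rho>2 by (auto simp: le_divide_eq)
  next
    case True
    then obtain p where p: "p \<in> P" "x \<in> ball p \<rho>" by blast
    define t where "t = 1 - (x - p) \<bullet> (x - p) / \<rho>\<^sup>2"
    note b = bumps_inside[OF \<rho>(1) P p]
    have t: "0 \<le> t" "t \<le> 1" using b(3,4) by (auto simp: t_def)
    have f: "bumps \<rho> P x = 1 - 2 * t\<^sup>2"
      and g: "(norm (grad_bumps \<rho> P x))\<^sup>2 = 64 * t\<^sup>2 * (1 - t) / \<rho>\<^sup>2"
      using b(1,2) by (auto simp: t_def)
    have t2: "0 \<le> t\<^sup>2" "t\<^sup>2 \<le> 1" using t by (auto simp: power_le_one)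
    have g0: "0 \<le> 64 * t\<^sup>2 * (1 - t)" using t by simp
    have "64 * t\<^sup>2 * (1 - t) \<le> 64"
      using mult_mono[of "t\<^sup>2" 1 "1 - t" 1] t t2 by simp
    moreover have "(1 - 2 * t\<^sup>2)\<^sup>2 \<le> 1"
      using t2 by (simp add: abs_square_le_1 abs_le_iff)
    moreover have "1 \<le> 1 / \<rho>\<^sup>2" using \<rho>2 by simp
    ultimately have up: "(1 - 2 * t\<^sup>2)\<^sup>2 + 64 * t\<^sup>2 * (1 - t) / \<rho>\<^sup>2 \<le> 1 / \<rho>\<^sup>2 + 64 / \<rho>\<^sup>2"
      using \<rho>2 by (intro add_mono divide_right_mono order_trans[OF _ \<open>1 \<le> 1 / \<rho>\<^sup>2\<close>]) auto
    have "64 * t\<^sup>2 * (1 - t) \<le> 64 * t\<^sup>2 * (1 - t) / \<rho>\<^sup>2"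
      using g0 \<rho>2 by (simp add: le_divide_eq mult_left_le)
    \<comment> \<open>The factored form exhibits the excess over 1 as nonnegative for
      \<open>t\<close> in [0, 1].\<close>
    moreover have "(1 - 2 * t\<^sup>2)\<^sup>2 + 64 * t\<^sup>2 * (1 - t) = 1 + 4 * t\<^sup>2 * (1 - t) * (15 - t)"
      by (simp add: algebra_simps power2_eq_square)
    moreover have "0 \<le> 4 * t\<^sup>2 * (1 - t) * (15 - t)" using t by simp
    ultimately have "1 \<le> (1 - 2 * t\<^sup>2)\<^sup>2 + 64 * t\<^sup>2 * (1 - t) / \<rho>\<^sup>2" by linarith
    with up show ?thesis by (simp add: f g add_divide_distrib[symmetric])
  qed
  \<comment> \<open>65 is rounded up to the perfect square 81.\<close>
  moreover have "65 / \<rho>\<^sup>2 \<le> (9 / \<rho>)\<^sup>2"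
    using \<rho>2 by (simp add: power_divide divide_right_mono)
  ultimately show "1 \<le> (bumps \<rho> P x)\<^sup>2 + (norm (grad_bumps \<rho> P x))\<^sup>2"
    "(bumps \<rho> P x)\<^sup>2 + (norm (grad_bumps \<rho> P x))\<^sup>2 \<le> (9 / \<rho>)\<^sup>2" by linarith+
qed

lemma exists_in_ball_scaled_inner:
  fixes p :: "'a::euclidean_space"
  assumes "\<rho> > 0" "0 \<le> s" "s < 1"
  obtains x where "x \<in> ball p \<rho>" "(x - p) \<bullet> (x - p) / \<rho>\<^sup>2 = s"
proof -
  obtain u :: 'a where u: "norm u = 1" using vector_choose_size[of 1] by auto
  let ?x = "p + (\<rho> * sqrt s) *\<^sub>R u"
  have "(?x - p) \<bullet> (?x - p) / \<rho>\<^sup>2 = s"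
    using assms u by (simp add: dot_square_norm power_mult_distrib)
  then show thesis
    using that[of ?x] scaled_inner_ge_1_iff[OF assms(1), of ?x p] assms(3) by auto
qed

section \<open>Zero set and condition number for balls packed inside the disk\<close>

context
  fixes a :: "'a::euclidean_space" and r \<rho> :: real and P :: "'a set"
  assumes r: "r > 0" and \<rho>: "0 < \<rho>" "\<rho> \<le> 1"
    and P: "finite P" "disjoint_family_on (\<lambda>p. ball p \<rho>) P" "P \<noteq> {}"
    and inside: "\<And>p. p \<in> P \<Longrightarrow> ball p \<rho> \<subseteq> ball a r"
begin

lemma zero_set_bumps_subset: "zero_set (cball a r) (bumps \<rho> P) \<subseteq> (\<Union>p\<in>P. ball p \<rho>)"
  using bumps_outside(1)[OF \<rho>(1), of P] by (force simp: zero_set_def)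

lemma zero_set_bumps_interior: "zero_set (cball a r) (bumps \<rho> P) \<subseteq> interior (cball a r)"
  using zero_set_bumps_subset inside by fastforce

lemma regular_zero_set_bumps: "regular_zero_set (cball a r) (bumps \<rho> P)"
  unfolding regular_zero_set_def
proof
  fix x assume "x \<in> zero_set (cball a r) (bumps \<rho> P)"
  then have x: "x \<in> cball a r" "bumps \<rho> P x = 0" by (auto simp: zero_set_def)
  show "gradient_on (cball a r) (bumps \<rho> P) x \<noteq> 0"
    \<comment> \<open>Where the value vanishes, the energy bound leaves a gradient of norm at least
      1.\<close>
    using bumps_energy_bounds(1)[OF \<rho> P(1,2), of x] x by (auto simp: gradient_on_bumps[OF r])
qed

lemma card_le_total_betti_bumps:
  "of_nat (card P) \<le> total_betti (zero_set (cball a r) (bumps \<rho> P))"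
proof -
  \<comment> \<open>This is the root of \<open>1 - 2 * (1 - s)^2\<close> in [0, 1), so the function
    vanishes at this scaled squared distance from each centre.\<close>
  let ?s = "1 - sqrt (1/2)"
  have s: "0 \<le> ?s" "?s < 1" by auto
  have "\<exists>x. x \<in> zero_set (cball a r) (bumps \<rho> P) \<inter> ball p \<rho>" if p: "p \<in> P" for p
  proof -
    obtain x where x: "x \<in> ball p \<rho>" "(x - p) \<bullet> (x - p) / \<rho>\<^sup>2 = ?s"
      using exists_in_ball_scaled_inner[OF \<rho>(1) s] by blast
    have "bumps \<rho> P x = 0"
      using bumps_inside(1)[OF \<rho>(1) P(1,2) p x(1)] unfolding x(2) by simp
    moreover have "x \<in> cball a r" using x(1) inside[OF p] by auto
    ultimately show ?thesis using x(1) by (auto simp: zero_set_def)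
  qed
  then obtain q where "\<And>p. p \<in> P \<Longrightarrow> q p \<in> zero_set (cball a r) (bumps \<rho> P) \<inter> ball p \<rho>"
    by metis
  then show ?thesis
    by (intro card_le_total_betti[OF P(1,2) _ zero_set_bumps_subset]) auto
qed

lemma boundary_min_bumps: "boundary_min (bumps \<rho> P) (cball a r) = 1"
proof -
  have "bumps \<rho> P x = 1" if "x \<in> frontier (cball a r)" for x
  proof (rule bumps_outside(1)[OF \<rho>(1)])
    show "x \<notin> ball p \<rho>" if "p \<in> P" for p
      using inside[OF that] \<open>x \<in> frontier (cball a r)\<close> r by auto
  qed
  moreover have "frontier (cball a r) \<noteq> {}" using r by simp
  ultimately show ?thesis
    unfolding boundary_min_def by (simp cong: INF_cong_simp)
qed

text \<open>The denominator is exactly 1: the boundary minimum is 1 and the energy bound gives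
  \<open>delta\<close> at least 1.\<close>

lemma kappa1_bumps_eq: "kappa1 (bumps \<rho> P) (cball a r) = nu1 (bumps \<rho> P) (cball a r)"
proof -
  have "1 \<le> delta (bumps \<rho> P) (cball a r)"
    unfolding delta_def
    using r bumps_energy_bounds(1)[OF \<rho> P(1,2)]
    by (intro cINF_greatest) (auto simp: gradient_on_bumps)
  then show ?thesis by (simp add: kappa1_def boundary_min_bumps)
qed

lemma kappa1_bumps_le: "kappa1 (bumps \<rho> P) (cball a r) \<le> 9 / \<rho>"
  unfolding kappa1_bumps_eq nu1_def
proof (rule cSUP_least)
  fix x assume "x \<in> cball a r"
  then show "sqrt (\<bar>bumps \<rho> P x\<bar>\<^sup>2 + (norm (gradient_on (cball a r) (bumps \<rho> P) x))\<^sup>2) \<le> 9 / \<rho>"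
    using bumps_energy_bounds(2)[OF \<rho> P(1,2), of x] r \<rho>
    by (intro real_le_lsqrt) (auto simp: gradient_on_bumps)
qed (use r in auto)

lemma kappa1_bumps_ge: "1 / \<rho> \<le> kappa1 (bumps \<rho> P) (cball a r)"
proof -
  let ?F = "\<lambda>x. sqrt (\<bar>bumps \<rho> P x\<bar>\<^sup>2 + (norm (gradient_on (cball a r) (bumps \<rho> P) x))\<^sup>2)"
  obtain p where p: "p \<in> P" using P by auto
  \<comment> \<open>At \<open>s = 1/4\<close>, halfway to the edge of the ball,
    \<open>64 * (1 - s)^2 * s = 9\<close>, so the gradient has norm
    \<open>3 / \<rho>\<close>.\<close>
  obtain x where x: "x \<in> ball p \<rho>" "(x - p) \<bullet> (x - p) / \<rho>\<^sup>2 = 1/4"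
    using exists_in_ball_scaled_inner[OF \<rho>(1), of "1/4"] by auto
  have xD: "x \<in> cball a r" using x inside[OF p] by auto
  have "(norm (grad_bumps \<rho> P x))\<^sup>2 = 9 / \<rho>\<^sup>2"
    using bumps_inside(2)[OF \<rho>(1) P(1,2) p x(1)] unfolding x(2) by (simp add: power2_eq_square)
  then have "(1 / \<rho>)\<^sup>2 \<le> (norm (grad_bumps \<rho> P x))\<^sup>2"
    using \<rho> by (simp add: power_divide divide_right_mono)
  then have "1 / \<rho> \<le> ?F x"
    using xD r by (intro real_le_rsqrt) (simp add: gradient_on_bumps add_increasing)
  also have "?F x \<le> nu1 (bumps \<rho> P) (cball a r)"
    unfolding nu1_def
  proof (rule cSUP_upper[OF xD], rule bdd_aboveI2)
    fix y assume "y \<in> cball a r"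
    then show "?F y \<le> 9 / \<rho>"
      using bumps_energy_bounds(2)[OF \<rho> P(1,2), of y] r \<rho>
      by (intro real_le_lsqrt) (auto simp: gradient_on_bumps)
  qed
  finally show ?thesis by (simp add: kappa1_bumps_eq)
qed

end

section \<open>Grids of centres\<close>

text \<open>The spacing \<open>2 * \<rho>\<close> just keeps open balls of radius
  \<open>\<rho>\<close> disjoint. The cube has \<open>a\<close> as a corner, so it occupies one
  orthant only; this affects just the constant.\<close>

definition grid :: "real ^ 'n \<Rightarrow> real \<Rightarrow> nat \<Rightarrow> (real ^ 'n) set"
  where "grid a \<rho> k = (\<lambda>z. a + (\<chi> i. 2 * \<rho> * real (z i))) ` (UNIV \<rightarrow> {..k})"

lemma card_grid:
  fixes a :: "real ^ 'n"
  assumes "\<rho> > 0"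
  shows "finite (grid a \<rho> k)" "card (grid a \<rho> k) = Suc k ^ CARD('n)"
proof -
  have inj: "inj_on (\<lambda>z. a + (\<chi> i. 2 * \<rho> * real (z i))) (UNIV \<rightarrow> {..k})"
    using assms by (auto simp: inj_on_def vec_eq_iff)
  have eq: "(UNIV :: 'n set) \<rightarrow> {..k} = PiE UNIV (\<lambda>_. {..k})"
    by (simp add: PiE_UNIV_domain Pi_def)
  show "finite (grid a \<rho> k)" unfolding grid_def eq by (intro finite_imageI finite_PiE) auto
  show "card (grid a \<rho> k) = Suc k ^ CARD('n)"
    unfolding grid_def card_image[OF inj] unfolding eq by (simp add: card_PiE)
qed

text \<open>Distinct grid points differ by at least \<open>2 * \<rho>\<close> in some coordinate,
  and a coordinate difference is at most the distance.\<close>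

lemma disjoint_balls_grid:
  assumes "\<rho> > 0"
  shows "disjoint_family_on (\<lambda>p. ball p \<rho>) (grid a \<rho> k)"
  unfolding disjoint_family_on_def
proof (intro ballI impI)
  fix p q assume pq: "p \<in> grid a \<rho> k" "q \<in> grid a \<rho> k" "p \<noteq> q"
  then obtain y z where p: "p = a + (\<chi> i. 2 * \<rho> * real (y i))"
    and q: "q = a + (\<chi> i. 2 * \<rho> * real (z i))"
    by (auto simp: grid_def)
  with pq obtain i where "y i \<noteq> z i" by (auto simp: vec_eq_iff)
  then have "1 \<le> \<bar>real (y i) - real (z i)\<bar>" by linarith
  then have "2 * \<rho> \<le> 2 * \<rho> * \<bar>real (y i) - real (z i)\<bar>" using assms by simp
  also have "\<dots> = \<bar>(p - q) $ i\<bar>"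
    using assms by (simp add: p q abs_mult right_diff_distrib[symmetric])
  also have "\<dots> \<le> dist p q" unfolding dist_norm by (rule component_le_norm_cart)
  finally show "ball p \<rho> \<inter> ball q \<rho> = {}"
    by (intro disjoint_ballI) simp
qed

text \<open>The Euclidean norm is bounded by the sum of the coordinates' absolute values. Passing
  from \<open>k\<close> to \<open>Suc k\<close> in the hypothesis leaves room for the radius
  \<open>\<rho>\<close>.\<close>

lemma ball_grid_subset:
  fixes a :: "real ^ 'n"
  assumes "\<rho> > 0" and bound: "2 * \<rho> * real CARD('n) * real (Suc k) \<le> r" and p: "p \<in> grid a \<rho> k"
  shows "ball p \<rho> \<subseteq> ball a r"
proof -
  obtain z where z: "z \<in> UNIV \<rightarrow> {..k}" "p = a + (\<chi> i. 2 * \<rho> * real (z i))"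
    using p by (auto simp: grid_def)
  have "dist p a = norm ((\<chi> i. 2 * \<rho> * real (z i)) :: real ^ 'n)" by (simp add: z(2) dist_norm)
  also have "\<dots> \<le> (\<Sum>i\<in>UNIV. \<bar>2 * \<rho> * real (z i)\<bar>)"
    using norm_le_l1_cart[of "(\<chi> i. 2 * \<rho> * real (z i)) :: real ^ 'n"] by simp
  also have "\<dots> \<le> (\<Sum>i\<in>(UNIV :: 'n set). 2 * \<rho> * real k)"
    using z(1) assms(1) by (intro sum_mono) (auto simp: abs_mult Pi_iff)
  also have "\<dots> = 2 * \<rho> * real CARD('n) * real k" by simp
  finally have "dist p a \<le> 2 * \<rho> * real CARD('n) * real k" .
  moreover have "1 \<le> 2 * real CARD('n)"
    using zero_less_card_finite[where 'a = 'n] by linarith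
  then have "\<rho> \<le> 2 * \<rho> * real CARD('n)"
    using mult_left_mono[of 1 "2 * real CARD('n)" \<rho>] assms(1) by (simp add: mult.assoc mult.left_commute)
  ultimately have "dist p a + \<rho> \<le> r" using bound by (simp add: algebra_simps)
  then show ?thesis by (simp add: ball_subset_ball_iff)
qed

section \<open>Choice of the radii and conclusion\<close>

theorem theorem185:
  fixes D :: "(real ^ 'n) set" and a :: "real ^ 'n" and r :: real
  assumes "r > 0" and "D = cball a r"
  shows "\<exists>(f :: nat \<Rightarrow> real ^ 'n \<Rightarrow> real) (c0 :: real).
    (\<forall>k. C1_on D (f k)) \<and>
    filterlim (\<lambda>k. kappa1 (f k) D) at_top sequentially \<and>
    c0 > 0 \<and>
    (\<forall>k. zero_set D (f k) \<subseteq> interior D \<and>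
         regular_zero_set D (f k) \<and>
         total_betti (zero_set D (f k)) \<ge> ennreal (c0 * kappa1 (f k) D ^ CARD('n)))"
proof -
  \<comment> \<open>With \<open>\<rho> k = c / (k + 1)\<close> the quantity bounded in
    \<open>ball_grid_subset\<close> equals \<open>min 1 r\<close> for every \<open>k\<close>: the
    \<open>r\<close> keeps the balls inside the disk, the 1 ensures
    \<open>\<rho> k \<le> 1\<close>.\<close>
  define c where "c = min 1 r / (2 * real CARD('n))"
  define \<rho> where "\<rho> k = c / real (Suc k)" for k
  define P where "P k = grid a (\<rho> k) k" for k
  define f where "f k = bumps (\<rho> k) (P k)" for k
  have n: "1 \<le> real CARD('n)"
    using zero_less_card_finite[where 'a = 'n] by linarith
  have c: "0 < c" using assms(1) by (simp add: c_def)
  have "min 1 r \<le> 2 * real CARD('n)" using n by linarith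
  then have c1: "c \<le> 1" by (simp add: c_def divide_le_eq)
  have \<rho>: "0 < \<rho> k" "\<rho> k \<le> 1" for k using c c1 by (auto simp: \<rho>_def divide_le_eq)
  have "2 * \<rho> k * real CARD('n) * real (Suc k) = min 1 r" for k
  proof -
    have "\<rho> k * real (Suc k) = c" by (simp add: \<rho>_def del: of_nat_Suc)
    moreover have "2 * real CARD('n) * c = min 1 r" by (simp add: c_def)
    ultimately show ?thesis by (metis mult.assoc mult.commute)
  qed
  then have inside: "ball p (\<rho> k) \<subseteq> ball a r" if "p \<in> P k" for p k
    using that \<rho> unfolding P_def by (intro ball_grid_subset) auto
  have P: "finite (P k)" "disjoint_family_on (\<lambda>p. ball p (\<rho> k)) (P k)"
    "card (P k) = Suc k ^ CARD('n)" for k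
    using card_grid disjoint_balls_grid \<rho> unfolding P_def by blast+
  have "P k \<noteq> {}" for k using P(3)[of k] by auto
  note bumps = assms(1) \<rho> P(1,2) this inside
  have kappa: "1 / \<rho> k \<le> kappa1 (f k) D" "kappa1 (f k) D \<le> 9 / \<rho> k" for k
    unfolding f_def assms(2)
    by (rule kappa1_bumps_ge[OF bumps], assumption) (rule kappa1_bumps_le[OF bumps])
  show ?thesis
  \<comment> \<open>The constant comes from
    \<open>kappa1 (f k) D \<le> 9 / \<rho> k = 9 * (k + 1) / c\<close>: scaling by
    \<open>c / 9\<close> gives at most \<open>k + 1\<close>, whose \<open>n\<close>-th power is the
    number of balls.\<close>
  proof (intro exI[of _ f] exI[of _ "(c / 9) ^ CARD('n)"] conjI allI)
    show "C1_on D (f k)" for k unfolding f_def assms(2) by (rule C1_on_bumps[OF assms(1)])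
    show "filterlim (\<lambda>k. kappa1 (f k) D) at_top sequentially"
    proof (rule filterlim_at_top_mono[OF filterlim_real_sequentially])
      have "real k \<le> 1 / \<rho> k" for k using c c1 by (simp add: \<rho>_def le_divide_eq mult_left_le add_increasing)
      then show "\<forall>\<^sub>F k in sequentially. real k \<le> kappa1 (f k) D"
        using kappa(1) by (intro always_eventually allI) (rule order_trans)
    qed
    show "0 < (c / 9) ^ CARD('n)" using c by simp
    show "zero_set D (f k) \<subseteq> interior D" for k
      unfolding f_def assms(2) by (rule zero_set_bumps_interior[OF bumps])
    show "regular_zero_set D (f k)" for k
      unfolding f_def assms(2) by (rule regular_zero_set_bumps[OF bumps])
    show "ennreal ((c / 9) ^ CARD('n) * kappa1 (f k) D ^ CARD('n)) \<le> total_betti (zero_set D (f k))" for k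
    proof -
      \<comment> \<open>Raising the upper bound to the \<open>n\<close>-th power requires a
        nonnegative base.\<close>
      have "0 \<le> kappa1 (f k) D" using kappa(1)[of k] \<rho>(1)[of k] by (smt (verit) divide_pos_pos)
      then have "(c / 9 * kappa1 (f k) D) ^ CARD('n) \<le> (c / 9 * (9 / \<rho> k)) ^ CARD('n)"
        using c kappa(2)[of k] by (intro power_mono mult_left_mono) auto
      also have "c / 9 * (9 / \<rho> k) = real (Suc k)" using c by (simp add: \<rho>_def)
      also have "\<dots> ^ CARD('n) = real (card (P k))" by (simp add: P(3))
      finally have "ennreal ((c / 9) ^ CARD('n) * kappa1 (f k) D ^ CARD('n)) \<le> of_nat (card (P k))"
        by (simp add: power_mult_distrib[symmetric] ennreal_of_nat_eq_real_of_nat ennreal_leI)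
      also have "\<dots> \<le> total_betti (zero_set D (f k))"
        unfolding f_def assms(2) by (rule card_le_total_betti_bumps[OF bumps])
      finally show ?thesis .
    qed
  qed
qed

end
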